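(* Let $G$ be a graph and $\alpha\ge 0$ an integer, and let $\mathcal{H}(G)$ be the injective hull of $G$. Then $G$ is $\alpha$-weakly-Helly if and only if for every vertex $h\in V(\mathcal{H}(G))$ there is a real vertex $v\in V(G)$ with $d_{\mathcal{H}(G)}(h,v)\le\alpha$.
   Context: All graphs are finite, simple, undirected, unweighted and connected. $D_G(v,r)=\{u\in V(G): d_G(u,v)\le r\}$ is the disk of radius $r$ around $v$. A graph $G$ is $\alpha$-weakly-Helly if for every family of disks $\{D_G(v,r(v)) : v\in S\}$, $S\subseteq V(G)$, that pairwise intersect, the disks $D_G(v,r(v)+\alpha)$, $v\in S$, have a common vertex; Helly graphs are the $0$-weakly-Helly graphs. The injective hull $\mathcal{H}(G)$ is the (unique) minimal Helly graph containing $G$ as an isometric subgraph; concretely its vertices are the functions $f:V(G)\to\mathbb{Z}_{\ge 0}$ with $f(x)+f(y)\ge d_G(x,y)$ for all $x,y$ and such that for every $x$ there is $y$ with $f(x)+f(y)=d_G(x,y)$; two such functions are adjacent iff $\max_{x}|f(x)-g(x)|=1$ (so distances are $\max_x|f(x)-g(x)|$), and $G$ is embedded isometrically by $z\mapsto d_G(z,\cdot)$. The images of vertices of $G$ are called real vertices and are identified with $V(G)$; the other vertices of $\mathcal{H}(G)$ are Helly vertices. *)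

theory Defs
  imports "Graph_Theory.Graph_Theory"
begin

text \<open>
  Hop distance: the library's infimum of walk costs, with every arc of cost \<open>1\<close>.
  It is \<open>\<infinity>\<close> between vertices not joined by a walk.
\<close>

definition gdist :: "('a, 'b) pre_digraph \<Rightarrow> 'a \<Rightarrow> 'a \<Rightarrow> ereal" where
  "gdist G u v = wf_digraph.\<mu> G (\<lambda>_. 1) u v"

definition disk :: "('a, 'b) pre_digraph \<Rightarrow> 'a \<Rightarrow> nat \<Rightarrow> 'a set" where
  "disk G v r = {u \<in> verts G. gdist G u v \<le> ereal (real r)}"

definition weakly_Helly :: "nat \<Rightarrow> ('a, 'b) pre_digraph \<Rightarrow> bool" where
  "weakly_Helly \<alpha> G \<longleftrightarrow>
     (\<forall>S \<subseteq> verts G. \<forall>r :: 'a \<Rightarrow> nat.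
        (\<forall>u \<in> S. \<forall>v \<in> S. disk G u (r u) \<inter> disk G v (r v) \<noteq> {}) \<longrightarrow>
        (\<exists>w \<in> verts G. \<forall>v \<in> S. w \<in> disk G v (r v + \<alpha>)))"

text \<open>
  Functions on the vertex set are represented as extensional functions, so that two
  hull vertices are equal iff they agree on \<open>verts G\<close>.
\<close>

definition hull_verts :: "('a, 'b) pre_digraph \<Rightarrow> ('a \<Rightarrow> nat) set" where
  "hull_verts G =
     {f \<in> verts G \<rightarrow>\<^sub>E UNIV.
        (\<forall>x \<in> verts G. \<forall>y \<in> verts G. gdist G x y \<le> ereal (real (f x + f y))) \<and>
        (\<forall>x \<in> verts G. \<exists>y \<in> verts G. ereal (real (f x + f y)) = gdist G x y)}"

definition injective_hull :: "('a, 'b) pre_digraph \<Rightarrow> ('a \<Rightarrow> nat) pair_pre_digraph" where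
  "injective_hull G =
     \<lparr> pverts = hull_verts G,
       parcs = {(f, g). f \<in> hull_verts G \<and> g \<in> hull_verts G \<and>
                  Max ((\<lambda>x. \<bar>int (f x) - int (g x)\<bar>) ` verts G) = 1} \<rparr>"

text \<open>
  The embedding \<open>z \<mapsto> d(z, \<cdot>)\<close>. In a connected graph all distances are finite natural
  numbers, so the conversion from \<^typ>\<open>ereal\<close> to \<^typ>\<open>nat\<close> loses nothing.
\<close>

definition real_vertex :: "('a, 'b) pre_digraph \<Rightarrow> 'a \<Rightarrow> 'a \<Rightarrow> nat" where
  "real_vertex G z = (\<lambda>x \<in> verts G. nat \<lfloor>real_of_ereal (gdist G z x)\<rfloor>)"

text \<open>
  The library characterizes \<open>wf_digraph.\<mu>\<close> only for well-formed digraphs; the hull is one.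
\<close>

lemma wf_injective_hull: "wf_digraph (with_proj (injective_hull G))"
  by unfold_locales (auto simp: injective_hull_def with_proj_def)

end

theory Submission
  imports Defs
begin

text \<open>
  A hull vertex \<open>h\<close> is at hull distance exactly \<open>h v\<close> from the real vertex of \<open>v\<close>, so the second
  condition says that every hull vertex takes a value at most \<open>\<alpha>\<close>. If \<open>G\<close> is weakly Helly, the
  disks of radii \<open>h v\<close> pairwise intersect, and a common vertex \<open>w\<close> of the enlarged disks satisfies
  \<open>h w \<le> \<alpha>\<close>, because \<open>h w + h y = d(w, y) \<le> h y + \<alpha>\<close> for some \<open>y\<close>. Conversely, the radii of
  pairwise intersecting disks (extended by the diameter) dominate a hull vertex \<open>h\<close>, and
  \<open>h v \<le> \<alpha>\<close> gives \<open>d(v, x) \<le> h v + h x \<le> \<alpha> + r x\<close>.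
\<close>

section \<open>Hop distance\<close>

text \<open>Stated for arbitrary well-formed digraphs so that it serves both \<open>G\<close> and
  its hull.\<close>

lemma gdist_le_iff:
  assumes "wf_digraph G"
  shows "gdist G u v \<le> ereal (real n) \<longleftrightarrow> (\<exists>p. pre_digraph.awalk G u p v \<and> length p \<le> n)"
proof -
  interpret wf_digraph G by fact
  have cost: "awalk_cost (\<lambda>_. 1) p = real (length p)" for p
    by (simp add: awalk_cost_def sum_list_triv)
  show ?thesis
  proof
    assume "gdist G u v \<le> ereal (real n)"
    \<comment> \<open>A strict bound on an infimum yields a witnessing walk, and integrality of
      lengths recovers \<open>n\<close> from \<open>Suc n\<close>.\<close>
    also have "\<dots> < ereal (real (Suc n))" by simp
    finally obtain p where "awalk u p v" "length p < Suc n"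
      unfolding gdist_def \<mu>_def by (auto simp: INF_less_iff cost)
    then show "\<exists>p. awalk u p v \<and> length p \<le> n" by auto
  next
    assume "\<exists>p. awalk u p v \<and> length p \<le> n"
    then obtain p where p: "awalk u p v" "length p \<le> n" by blast
    have "gdist G u v \<le> ereal (real (length p))"
      unfolding gdist_def using min_cost_le_walk_cost[OF p(1), of "\<lambda>_. 1"] by (simp add: cost)
    also have "\<dots> \<le> ereal (real n)" using p(2) by simp
    finally show "gdist G u v \<le> ereal (real n)" .
  qed
qed

lemma (in sym_digraph) awalk_reverse:
  assumes "awalk u p v"
  shows "\<exists>q. awalk v q u \<and> length q = length p"
  using assms
proof (induction p arbitrary: u)
  case Nil
  then show ?case by (auto simp: awalk_Nil_iff)
next
  case (Cons e p)
  then have e: "e \<in> arcs G" "u = tail G e" and "awalk (head G e) p v"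
    by (auto simp: awalk_Cons_iff)
  then obtain q where q: "awalk v q (head G e)" "length q = length p"
    using Cons.IH by blast
  have "(head G e, tail G e) \<in> arcs_ends G"
    using e(1) sym_arcs by (auto simp: symmetric_def arcs_ends_conv dest: symD)
  then obtain e' where "e' \<in> arcs G" "tail G e' = head G e" "head G e' = tail G e"
    by (auto simp: arcs_ends_conv)
  then have "awalk (head G e) [e'] u"
    using e arc_implies_awalk[of e'] by simp
  with q have "awalk v (q @ [e']) u" by (blast intro: awalk_appendI)
  then show ?case using q(2) by (intro exI[of _ "q @ [e']"]) simp
qed

locale connected_graph = graph G for G :: "('a, 'b) pre_digraph" (structure) +
  assumes connected: "Digraph_Component.connected G"
begin

text \<open>The same conversion as in \<open>real_vertex\<close>, so that real vertices unfold to
  \<open>dst z\<close>.\<close>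

definition dst :: "'a \<Rightarrow> 'a \<Rightarrow> nat" where
  "dst u v = nat \<lfloor>real_of_ereal (gdist G u v)\<rfloor>"

text \<open>Connectedness enters here: the infimum is attained by a walk, so it is a natural
  number.\<close>

lemma gdist_eq_dst:
  assumes "u \<in> verts G" "v \<in> verts G"
  shows "gdist G u v = ereal (real (dst u v))"
proof -
  have "u \<rightarrow>\<^sup>* v"
    using assms symmetric_connected_imp_strongly_connected[OF sym_arcs connected]
    by (auto elim: strongly_connectedE)
  then obtain p where "\<mu> (\<lambda>_. 1) u v = awalk_cost (\<lambda>_. 1) p"
    using min_cost_awalk[of u v "\<lambda>_. 1"] by auto
  then have "gdist G u v = ereal (real (length p))"
    by (simp add: gdist_def awalk_cost_def sum_list_triv)
  then show ?thesis by (simp add: dst_def)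
qed

lemma dst_le_iff:
  assumes "u \<in> verts G" "v \<in> verts G"
  shows "dst u v \<le> n \<longleftrightarrow> (\<exists>p. awalk u p v \<and> length p \<le> n)"
  using gdist_le_iff[OF wf_digraph, of u v n] assms by (simp add: gdist_eq_dst)

lemma dst_self: "u \<in> verts G \<Longrightarrow> dst u u = 0"
  using dst_le_iff[of u u 0] by (simp add: awalk_Nil_iff)

lemma shortest_awalk:
  assumes "u \<in> verts G" "v \<in> verts G"
  obtains p where "awalk u p v" "length p \<le> dst u v"
  using dst_le_iff[OF assms, of "dst u v"] by auto

lemma dst_le_length: "awalk u p v \<Longrightarrow> dst u v \<le> length p"
  using dst_le_iff[of u v "length p"] by blast

lemma dst_commute:
  assumes "u \<in> verts G" "v \<in> verts G"
  shows "dst u v = dst v u"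
proof -
  have "dst v u \<le> dst u v" if "u \<in> verts G" "v \<in> verts G" for u v
    using that by (metis shortest_awalk awalk_reverse dst_le_length order_trans)
  then show ?thesis using assms by (simp add: order_antisym)
qed

lemma dst_triangle:
  assumes "u \<in> verts G" "v \<in> verts G" "w \<in> verts G"
  shows "dst u w \<le> dst u v + dst v w"
proof -
  obtain p where p: "awalk u p v" "length p \<le> dst u v" using assms shortest_awalk by blast
  obtain q where q: "awalk v q w" "length q \<le> dst v w" using assms shortest_awalk by blast
  show ?thesis using dst_le_length[OF awalk_appendI[OF p(1) q(1)]] p(2) q(2) by simp
qed

lemma disk_iff:
  assumes "v \<in> verts G"
  shows "u \<in> disk G v r \<longleftrightarrow> u \<in> verts G \<and> dst u v \<le> r"
  using assms by (auto simp: disk_def gdist_eq_dst)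

lemma disks_intersect_iff:
  assumes uv: "u \<in> verts G" "v \<in> verts G"
  shows "disk G u r \<inter> disk G v s \<noteq> {} \<longleftrightarrow> dst u v \<le> r + s"
proof
  assume "disk G u r \<inter> disk G v s \<noteq> {}"
  then obtain w where "w \<in> verts G" "dst w u \<le> r" "dst w v \<le> s"
    using uv by (auto simp: disk_iff)
  then show "dst u v \<le> r + s"
    using uv dst_triangle[of u w v] dst_commute[of u w] by simp
next
  assume le: "dst u v \<le> r + s"
  obtain p where p: "awalk u p v" "length p \<le> dst u v" using uv shortest_awalk by blast
  \<comment> \<open>The common vertex lies \<open>r\<close> arcs along a shortest walk, or is
    \<open>v\<close> if the walk is shorter than that.\<close>
  define w where "w = awlast u (take r p)"
  have "awalk u (take r p @ drop r p) v" using p(1) by simp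
  then have "awalk u (take r p) w" "awalk w (drop r p) v"
    unfolding w_def awalk_append_iff by auto
  then have w: "w \<in> verts G" "dst u w \<le> length (take r p)" "dst w v \<le> length (drop r p)"
    by (blast intro: dst_le_length)+
  moreover have "length (take r p) \<le> r" "length (drop r p) \<le> s"
    using le p(2) by auto
  ultimately have "w \<in> disk G u r \<inter> disk G v s"
    using uv dst_commute[of u w] by (simp add: disk_iff)
  then show "disk G u r \<inter> disk G v s \<noteq> {}" by blast
qed

section \<open>The injective hull\<close>

lemma pverts_injective_hull [simp]: "pverts (injective_hull G) = hull_verts G"
  by (simp add: injective_hull_def)

lemma hull_verts_iff:
  "f \<in> hull_verts G \<longleftrightarrow> f \<in> extensional (verts G) \<and>
     (\<forall>x \<in> verts G. \<forall>y \<in> verts G. dst x y \<le> f x + f y) \<and>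
     (\<forall>x \<in> verts G. \<exists>y \<in> verts G. f x + f y = dst x y)"
proof -
  \<comment> \<open>Deleting \<open>of_nat_add\<close> below keeps \<open>f x + f y\<close> under a
    single cast, so comparisons in \<open>ereal\<close> become comparisons of naturals.\<close>
  have "ereal (real m) = ereal (real n) \<longleftrightarrow> m = n" for m n by simp
  then show ?thesis
    by (simp add: hull_verts_def PiE_def gdist_eq_dst del: of_nat_add cong: ball_cong bex_cong)
qed

lemma dst_le_hull:
  "f \<in> hull_verts G \<Longrightarrow> x \<in> verts G \<Longrightarrow> y \<in> verts G \<Longrightarrow> dst x y \<le> f x + f y"
  by (simp add: hull_verts_iff)

lemma hull_partner:
  assumes "f \<in> hull_verts G" "x \<in> verts G"
  obtains y where "y \<in> verts G" "f x + f y = dst x y"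
  using assms unfolding hull_verts_iff by blast

lemma real_vertex_apply: "x \<in> verts G \<Longrightarrow> real_vertex G z x = dst z x"
  by (simp add: real_vertex_def dst_def)

text \<open>The triangle inequality through \<open>z\<close> gives the lower bound, and
  \<open>z\<close> itself is a partner of every vertex.\<close>

lemma real_vertex_in_hull:
  assumes "z \<in> verts G"
  shows "real_vertex G z \<in> hull_verts G"
  unfolding hull_verts_iff
proof (intro conjI ballI)
  show "real_vertex G z \<in> extensional (verts G)" by (simp add: real_vertex_def)
  show "dst x y \<le> real_vertex G z x + real_vertex G z y"
    if "x \<in> verts G" "y \<in> verts G" for x y
    using assms that dst_triangle[of x z y] dst_commute[of x z] by (simp add: real_vertex_apply)
  show "\<exists>y\<in>verts G. real_vertex G z x + real_vertex G z y = dst x y" if "x \<in> verts G" for x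
    using assms that
    by (intro bexI[of _ z]) (simp_all add: real_vertex_apply dst_self dst_commute[of x z])
qed

text \<open>Among the admissible functions below \<open>p\<close>, one with least sum is a hull
  vertex: if some \<open>x\<close> had no partner, all inequalities at \<open>x\<close> would be
  strict and the value there could drop by 1.\<close>

lemma hull_vert_below:
  assumes p: "\<And>x y. x \<in> verts G \<Longrightarrow> y \<in> verts G \<Longrightarrow> dst x y \<le> p x + p y"
  obtains f where "f \<in> hull_verts G" "\<And>x. x \<in> verts G \<Longrightarrow> f x \<le> p x"
proof -
  define below where "below f \<longleftrightarrow> f \<in> extensional (verts G) \<and> (\<forall>x\<in>verts G. f x \<le> p x) \<and>
    (\<forall>x\<in>verts G. \<forall>y\<in>verts G. dst x y \<le> f x + f y)" for f
  have "below (restrict p (verts G))" using p by (simp add: below_def)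
  then obtain f where f: "below f" and least: "\<And>g. below g \<Longrightarrow> sum f (verts G) \<le> sum g (verts G)"
    using ex_has_least_nat[of below _ "\<lambda>f. sum f (verts G)"] by blast
  have "\<exists>y\<in>verts G. f x + f y = dst x y" if x: "x \<in> verts G" for x
  proof (rule ccontr)
    assume "\<not> ?thesis"
    then have strict: "dst x y < f x + f y" if "y \<in> verts G" for y
      using f x that unfolding below_def by (metis le_neq_implies_less)
    \<comment> \<open>Strictness for the pair \<open>x\<close>, \<open>x\<close> makes the truncated
      subtraction \<open>f x - 1\<close> a genuine decrease.\<close>
    then have pos: "0 < f x" using strict[OF x] by simp
    have strict': "dst y x < f x + f y" if "y \<in> verts G" for y
      using strict[OF that] dst_commute[OF x that] by simp
    define g where "g = f(x := f x - 1)"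
    have "dst y z \<le> g y + g z" if yz: "y \<in> verts G" "z \<in> verts G" for y z
    proof -
      have "dst y z \<le> f y + f z" using f yz by (simp add: below_def)
      \<comment> \<open>If exactly one of \<open>y\<close>, \<open>z\<close> is \<open>x\<close>,
        strictness absorbs the loss of 1; if both are, the distance is 0.\<close>
      then show ?thesis
        using strict[of z] strict'[of y] yz dst_self[OF x] unfolding g_def by auto
    qed
    moreover have "g \<in> extensional (verts G)"
      using f x by (auto simp: below_def g_def extensional_def)
    moreover have "g y \<le> p y" if "y \<in> verts G" for y
    proof -
      have "g y \<le> f y" by (simp add: g_def)
      also have "\<dots> \<le> p y" using f that by (simp add: below_def)
      finally show ?thesis .
    qed
    ultimately have "below g" by (simp add: below_def)
    moreover have "sum g (verts G) < sum f (verts G)"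
      using x pos by (intro sum_strict_mono_ex1) (auto simp: g_def)
    ultimately show False using least[of g] by simp
  qed
  then have "f \<in> hull_verts G" using f by (auto simp: hull_verts_iff below_def)
  then show thesis using that f by (simp add: below_def)
qed

text \<open>By minimality, a one-sided bound between hull vertices is already two-sided.\<close>

lemma hull_le_swap:
  assumes "f \<in> hull_verts G" "g \<in> hull_verts G"
    and le: "\<And>x. x \<in> verts G \<Longrightarrow> f x \<le> g x + n" and x: "x \<in> verts G"
  shows "g x \<le> f x + n"
proof -
  obtain y where "y \<in> verts G" "g x + g y = dst x y" using assms hull_partner by blast
  then show ?thesis using dst_le_hull[OF assms(1) x, of y] le[of y] by simp
qed

lemma hull_adjI:
  assumes fg: "f \<in> hull_verts G" "g \<in> hull_verts G" "f \<noteq> g"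
    and le: "\<And>x. x \<in> verts G \<Longrightarrow> f x \<le> g x + 1"
  shows "(f, g) \<in> arcs (with_proj (injective_hull G))"
proof -
  let ?D = "(\<lambda>x. \<bar>int (f x) - int (g x)\<bar>) ` verts G"
  \<comment> \<open>Distinct extensional functions differ at some vertex, so the maximum is 1 and
    not 0.\<close>
  obtain x where x: "x \<in> verts G" "f x \<noteq> g x"
    using fg by (metis hull_verts_iff extensionalityI)
  have le1: "\<bar>int (f x) - int (g x)\<bar> \<le> 1" if "x \<in> verts G" for x
    using le[OF that] hull_le_swap[OF fg(1,2) le that] by linarith
  have "\<bar>int (f x) - int (g x)\<bar> = 1" using le1[OF x(1)] x(2) by linarith
  then have "1 \<in> ?D" by (intro rev_image_eqI[OF x(1)]) simp
  then have "Max ?D = 1" using le1 by (intro Max_eqI) auto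
  then show ?thesis using fg by (simp add: injective_hull_def)
qed

lemma hull_adjD:
  assumes "(f, g) \<in> arcs (with_proj (injective_hull G))" and x: "x \<in> verts G"
  shows "f x \<le> g x + 1"
proof -
  have "\<bar>int (f x) - int (g x)\<bar> \<le> Max ((\<lambda>x. \<bar>int (f x) - int (g x)\<bar>) ` verts G)"
    using x by (intro Max_ge) auto
  also have "\<dots> = 1" using assms(1) by (simp add: injective_hull_def)
  finally show ?thesis by linarith
qed

lemma hull_awalk_bound:
  assumes "pre_digraph.awalk (with_proj (injective_hull G)) f p g" and x: "x \<in> verts G"
  shows "f x \<le> g x + length p"
proof -
  interpret H: wf_digraph "with_proj (injective_hull G)" by (rule wf_injective_hull)
  show ?thesis
    using assms(1)
  proof (induction p arbitrary: f)
    case Nil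
    then show ?case by (simp add: H.awalk_Nil_iff)
  next
    case (Cons e p)
    then have "e \<in> arcs (with_proj (injective_hull G))" "f = fst e" "H.awalk (snd e) p g"
      by (simp_all add: H.awalk_Cons_iff)
    then show ?case using hull_adjD[of f "snd e", OF _ x] Cons.IH[of "snd e"] by simp
  qed
qed

text \<open>The hull has enough vertices to realize the maximum distance by walks; the induction
  finds the first step towards \<open>g\<close>.\<close>

lemma hull_awalk_exists:
  assumes "f \<in> hull_verts G" "g \<in> hull_verts G" "\<And>x. x \<in> verts G \<Longrightarrow> f x \<le> g x + n"
  shows "\<exists>p. pre_digraph.awalk (with_proj (injective_hull G)) f p g \<and> length p \<le> n"
proof -
  interpret H: wf_digraph "with_proj (injective_hull G)" by (rule wf_injective_hull)
  show ?thesis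
    using assms
  proof (induction n arbitrary: f)
    case 0
    have "f x = g x" if "x \<in> verts G" for x
      using "0.prems"(3)[OF that] hull_le_swap[OF 0 that] by simp
    then have "f = g" using 0 by (metis hull_verts_iff extensionalityI)
    then show ?case using 0
      by (intro exI[of _ "[]"]) (simp add: H.awalk_Nil_iff)
  next
    case (Suc n)
    \<comment> \<open>A hull vertex below \<open>p\<close> is within one step of \<open>f\<close> and within \<open>n\<close> steps of \<open>g\<close>.\<close>
    define p where "p x = min (f x + 1) (g x + n)" for x
    \<comment> \<open>In the mixed case, \<open>f y \<le> g y + Suc n\<close> gives
      \<open>f x + f y \<le> (f x + 1) + (g y + n)\<close>.\<close>
    have "dst x y \<le> p x + p y" if "x \<in> verts G" "y \<in> verts G" for x y
      using dst_le_hull[OF Suc.prems(1) that] dst_le_hull[OF Suc.prems(2) that]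
        Suc.prems(3)[OF that(1)] Suc.prems(3)[OF that(2)]
      unfolding p_def by linarith
    then obtain f' where f': "f' \<in> hull_verts G" and below: "\<And>x. x \<in> verts G \<Longrightarrow> f' x \<le> p x"
      using hull_vert_below by blast
    have "\<And>x. x \<in> verts G \<Longrightarrow> f' x \<le> g x + n" using below by (simp add: p_def)
    then obtain q where q: "H.awalk f' q g" "length q \<le> n"
      using Suc.IH[OF f' Suc.prems(2)] by blast
    have "\<And>x. x \<in> verts G \<Longrightarrow> f' x \<le> f x + 1" using below by (simp add: p_def)
    then have le: "\<And>x. x \<in> verts G \<Longrightarrow> f x \<le> f' x + 1"
      by (rule hull_le_swap[OF f' Suc.prems(1)])
    show ?case
    \<comment> \<open>The hull has no loops, so a step that stays at \<open>f\<close> is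
      omitted.\<close>
    proof (cases "f = f'")
      case True
      then show ?thesis using q by auto
    next
      case False
      then have "H.awalk f ((f, f') # q) g"
        using hull_adjI[OF Suc.prems(1) f' _ le] q(1) by (simp add: H.awalk_Cons_iff)
      then show ?thesis using q(2) by (intro exI[of _ "(f, f') # q"]) simp
    qed
  qed
qed

lemma hull_gdist_le_iff:
  assumes "f \<in> hull_verts G" "g \<in> hull_verts G"
  shows "gdist (with_proj (injective_hull G)) f g \<le> ereal (real n) \<longleftrightarrow>
    (\<forall>x\<in>verts G. f x \<le> g x + n)"
  unfolding gdist_le_iff[OF wf_injective_hull]
  using hull_awalk_exists[OF assms] hull_awalk_bound[of f _ g]
  by (meson add_left_mono order_trans)

text \<open>At \<open>x = v\<close> the distance bound reads \<open>h v \<le> n\<close>. Conversely,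
  admissibility of \<open>h\<close> bounds the real vertex by \<open>h x + n\<close>, and
  \<open>hull_le_swap\<close> turns this around.\<close>

lemma hull_gdist_real_vertex_le_iff:
  assumes h: "h \<in> hull_verts G" and v: "v \<in> verts G"
  shows "gdist (with_proj (injective_hull G)) h (real_vertex G v) \<le> ereal (real n) \<longleftrightarrow> h v \<le> n"
  unfolding hull_gdist_le_iff[OF h real_vertex_in_hull[OF v]]
proof
  assume "\<forall>x\<in>verts G. h x \<le> real_vertex G v x + n"
  then show "h v \<le> n" using v by (auto simp: real_vertex_apply dst_self)
next
  assume "h v \<le> n"
  then have "real_vertex G v x \<le> h x + n" if "x \<in> verts G" for x
    using dst_le_hull[OF h v that] that by (simp add: real_vertex_apply)
  then show "\<forall>x\<in>verts G. h x \<le> real_vertex G v x + n"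
    using hull_le_swap[OF real_vertex_in_hull[OF v] h] by blast
qed

section \<open>The weak Helly property\<close>

lemma weakly_Helly_imp_hull_small_value:
  assumes "weakly_Helly \<alpha> G" and h: "h \<in> hull_verts G"
  shows "\<exists>v\<in>verts G. h v \<le> \<alpha>"
proof -
  have "disk G u (h u) \<inter> disk G v (h v) \<noteq> {}" if "u \<in> verts G" "v \<in> verts G" for u v
    using that by (simp only: disks_intersect_iff dst_le_hull[OF h])
  then have "\<exists>w\<in>verts G. \<forall>v\<in>verts G. w \<in> disk G v (h v + \<alpha>)"
    using assms(1)[unfolded weakly_Helly_def, rule_format, of "verts G" h] by simp
  then obtain w where w: "w \<in> verts G" "\<And>v. v \<in> verts G \<Longrightarrow> w \<in> disk G v (h v + \<alpha>)"
    by blast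
  obtain y where "y \<in> verts G" "h w + h y = dst w y" using hull_partner[OF h w(1)] .
  then have "h w \<le> \<alpha>" using w(2)[of y] by (simp add: disk_iff)
  then show ?thesis using w(1) by blast
qed

lemma hull_small_value_imp_weakly_Helly:
  assumes small: "\<And>h. h \<in> hull_verts G \<Longrightarrow> \<exists>v\<in>verts G. h v \<le> \<alpha>"
  shows "weakly_Helly \<alpha> G"
  unfolding weakly_Helly_def
proof (intro allI impI)
  fix S and r :: "'a \<Rightarrow> nat"
  assume S: "S \<subseteq> verts G" and meet: "\<forall>u\<in>S. \<forall>v\<in>S. disk G u (r u) \<inter> disk G v (r v) \<noteq> {}"
  \<comment> \<open>The diameter as default radius outside \<open>S\<close> satisfies every
    inequality that involves a vertex outside \<open>S\<close>.\<close>
  define N where "N = Max ((\<lambda>(x, y). dst x y) ` (verts G \<times> verts G))"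
  define p where "p x = (if x \<in> S then r x else N)" for x
  have N: "dst x y \<le> N" if "x \<in> verts G" "y \<in> verts G" for x y
    unfolding N_def using that by (intro Max_ge) (auto intro!: image_eqI[of _ _ "(x, y)"])
  have "dst x y \<le> r x + r y" if "x \<in> S" "y \<in> S" for x y
    using S meet that disks_intersect_iff[of x y] by blast
  then have "dst x y \<le> p x + p y" if "x \<in> verts G" "y \<in> verts G" for x y
    using N[OF that] by (auto simp: p_def)
  then obtain h where h: "h \<in> hull_verts G" and below: "\<And>x. x \<in> verts G \<Longrightarrow> h x \<le> p x"
    using hull_vert_below by blast
  obtain v where v: "v \<in> verts G" "h v \<le> \<alpha>" using small[OF h] by blast
  have "v \<in> disk G x (r x + \<alpha>)" if "x \<in> S" for x
  proof -
    have x: "x \<in> verts G" using S that by blast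
    have "dst v x \<le> r x + \<alpha>"
      using dst_le_hull[OF h v(1) x] v(2) below[OF x] that by (simp add: p_def)
    then show ?thesis using v x by (simp add: disk_iff)
  qed
  then show "\<exists>w\<in>verts G. \<forall>v\<in>S. w \<in> disk G v (r v + \<alpha>)" using v(1) by blast
qed

end

theorem theorem1:
  fixes G :: "('a, 'b) pre_digraph" and \<alpha> :: nat
  assumes "graph G" and "Digraph_Component.connected G"
  shows "weakly_Helly \<alpha> G \<longleftrightarrow>
    (\<forall>h \<in> verts (with_proj (injective_hull G)). \<exists>v \<in> verts G.
       gdist (with_proj (injective_hull G)) h (real_vertex G v) \<le> ereal (real \<alpha>))"
proof -
  interpret connected_graph G
    using assms by (simp add: connected_graph_def connected_graph_axioms_def)
  show ?thesis
    using weakly_Helly_imp_hull_small_value hull_small_value_imp_weakly_Helly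
    by (auto simp: hull_gdist_real_vertex_le_iff)
qed

end
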